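(* Let $H,K$ be complex Banach spaces, let $A_0,A_1\in\mathcal L(H,K)$ with $A_0$ singular, let $s,r\in\mathbb R$ with $0\le s<r$, and let $\{R_j\}_{j\in\mathbb Z}$ be a family in $\mathcal L(K,H)$. Then $\{R_j\}_{j\in\mathbb Z}$ satisfies the three conditions (a) for all $\delta,\epsilon>0$ with $s<s+\epsilon<r-\delta<r$ there are constants $c_\delta,d_\epsilon$ such that $\|R_j\|\le c_\delta/(r-\delta)^j$ and $\|R_{-j}\|\le d_\epsilon(s+\epsilon)^j$ for all $j\in\mathbb N$; (b) $R_{-1}A_1+R_0A_0=I$ on $H$, and $R_{j-1}A_1+R_jA_0=0$ for all $j\in\mathbb Z$ with $j\ne0$; (c) $A_1R_{-1}+A_0R_0=I$ on $K$, and $A_1R_{j-1}+A_0R_j=0$ for all $j\in\mathbb Z$ with $j\neq0$; if and only if the following are all satisfied: (i) $P=R_{-1}A_1\in\mathcal L(H)$ and $I-P=R_0A_0\in\mathcal L(H)$ are complementary projections on $H$, and $Q=A_1R_{-1}\in\mathcal L(K)$ and $I-Q=A_0R_0\in\mathcal L(K)$ are complementary projections on $K$ (that is, $P$ and $Q$ are idempotent, $R_{-1}A_1+R_0A_0=I$ and $A_1R_{-1}+A_0R_0=I$); (ii) $A_i=QA_iP+(I-Q)A_i(I-P)$ for $i=0,1$; (iii) $R_j=PR_jQ$ for $j\le-1$ and $R_j=(I-P)R_j(I-Q)$ for $j\ge0$; (iv) $R_{-j}=(-1)^{j-1}(R_{-1}A_0)^{j-1}R_{-1}$ and $R_j=(-1)^j(R_0A_1)^jR_0$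 for all $j\in\mathbb N$; (v) $\lim_{j\to\infty}\|(R_{-1}A_0)^j\|^{1/j}\le s$ and $\lim_{j\to\infty}\|(R_0A_1)^j\|^{1/j}\le 1/r$.
   Context: $\mathcal L(H,K)$ denotes the bounded linear operators from $H$ to $K$ with the operator norm, and $\mathcal L(H)=\mathcal L(H,H)$. $\mathbb N=\{1,2,\ldots\}$. "$A_0$ is singular" means that $A_0$ has no inverse in $\mathcal L(K,H)$. A projection is a bounded idempotent operator. $I$ denotes the identity operator on $H$ or $K$ as appropriate. *)

theory Defs
  imports "HOL-Analysis.Analysis"
begin

text \<open>
  The distribution only has real Banach spaces (class \<^class>\<open>banach\<close>).  A complex Banach space
  is one with a complex scalar multiplication that extends the real one and for which the norm
  is absolutely homogeneous.
\<close>

class complex_banach = banach +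
  fixes scaleC :: "complex \<Rightarrow> 'a \<Rightarrow> 'a"  (infixr \<open>*\<^sub>C\<close> 75)
  assumes scaleC_add_right: "a *\<^sub>C (x + y) = a *\<^sub>C x + a *\<^sub>C y"
    and scaleC_add_left: "(a + b) *\<^sub>C x = a *\<^sub>C x + b *\<^sub>C x"
    and scaleC_scaleC: "a *\<^sub>C (b *\<^sub>C x) = (a * b) *\<^sub>C x"
    and scaleC_one: "1 *\<^sub>C x = x"
    and scaleR_scaleC: "r *\<^sub>R x = complex_of_real r *\<^sub>C x"
    and norm_scaleC: "norm (a *\<^sub>C x) = cmod a * norm x"

instantiation complex :: complex_banach
begin

definition scaleC_complex :: "complex \<Rightarrow> complex \<Rightarrow> complex"
  where "scaleC_complex a x = a * x"

instance
  by standard (auto simp: scaleC_complex_def algebra_simps scaleR_conv_of_real norm_mult)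

end

text \<open>
  \<open>bounded_ops\<close>, at type \<open>('h \<Rightarrow>\<^sub>L 'k) set\<close>, is the space of bounded complex-linear operators:
  the elements of \<^typ>\<open>'h \<Rightarrow>\<^sub>L 'k\<close> are bounded and real-linear, with the operator norm.
\<close>

definition bounded_ops :: "('h::complex_banach \<Rightarrow>\<^sub>L 'k::complex_banach) set"
  where "bounded_ops = {T. \<forall>a x. blinfun_apply T (a *\<^sub>C x) = a *\<^sub>C blinfun_apply T x}"

definition singular_op :: "('h::complex_banach \<Rightarrow>\<^sub>L 'k::complex_banach) \<Rightarrow> bool"
  where "singular_op A \<longleftrightarrow>
    \<not> (\<exists>B\<in>bounded_ops. B o\<^sub>L A = id_blinfun \<and> A o\<^sub>L B = id_blinfun)"

primrec op_power :: "('h::complex_banach \<Rightarrow>\<^sub>L 'h) \<Rightarrow> nat \<Rightarrow> ('h \<Rightarrow>\<^sub>L 'h)"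
  where
    "op_power T 0 = id_blinfun"
  | "op_power T (Suc n) = T o\<^sub>L op_power T n"

definition projection :: "('h::complex_banach \<Rightarrow>\<^sub>L 'h) \<Rightarrow> bool"
  where "projection P \<longleftrightarrow> P \<in> bounded_ops \<and> P o\<^sub>L P = P"

definition complementary_projections ::
    "('h::complex_banach \<Rightarrow>\<^sub>L 'h) \<Rightarrow> ('h \<Rightarrow>\<^sub>L 'h) \<Rightarrow> bool"
  where "complementary_projections P P' \<longleftrightarrow>
    projection P \<and> projection P' \<and> P + P' = id_blinfun"

end

theory Submission
  imports Defs
begin

text \<open>
  By (b) and (c), \<open>F i j = R i o\<^sub>L A1 o\<^sub>L R j\<close> is constant along antidiagonals \<open>i + j = n\<close>,
  except for explicit jumps where \<open>i\<close> or \<open>j\<close> changes sign.  By (a), \<open>F i j\<close> tends to zero along an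
  antidiagonal as \<open>i\<close> tends to infinity, so \<open>F i j\<close> equals \<open>R (i + j + 1)\<close> if both indices are
  negative, \<open>- R (i + j + 1)\<close> if both are nonnegative, and zero otherwise.  Statements (i)--(iv)
  are read off from these values, and (v) follows from (a) because the powers of
  \<open>R (-1) o\<^sub>L A0\<close> and \<open>R 0 o\<^sub>L A1\<close> are, up to sign, \<open>R (-j) o\<^sub>L A0\<close> and \<open>R (j - 1) o\<^sub>L A1\<close>.
  The converse is direct algebra, since the projections intertwine both coefficients.
\<close>

section \<open>Roots of submultiplicative sequences\<close>

lemma submult_power_le:
  fixes a :: "nat \<Rightarrow> real"
  assumes nn: "\<And>n. 0 \<le> a n" and sub: "\<And>m n. a (m + n) \<le> a m * a n"
  shows "a (q * m + p) \<le> a m ^ q * a p"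
proof (induction q)
  case (Suc q)
  have "a (Suc q * m + p) = a (m + (q * m + p))" by (simp add: algebra_simps)
  also have "\<dots> \<le> a m * a (q * m + p)" by (rule sub)
  also have "\<dots> \<le> a m * (a m ^ q * a p)" by (rule mult_left_mono[OF Suc nn])
  finally show ?case by (simp add: algebra_simps)
qed simp

text \<open>Division with remainder: if \<open>n = q * m + p\<close> with \<open>p < m\<close>, the
  \<open>q\<close> full blocks contribute at most \<open>x ^ (q * m)\<close>, and the finitely many
  remainders \<open>p\<close> are absorbed into the constant.\<close>

lemma submult_geometric_bound:
  fixes a :: "nat \<Rightarrow> real"
  assumes nn: "\<And>n. 0 \<le> a n" and sub: "\<And>m n. a (m + n) \<le> a m * a n"
    and m: "0 < m" and x: "0 < x" and am: "a m \<le> x ^ m"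
  shows "\<exists>C>0. \<forall>n. a n \<le> C * x ^ n"
proof -
  \<comment> \<open>Each ratio \<open>a p / x ^ p\<close> is at most the whole sum, so
    \<open>a p <= C * x ^ p\<close> for every remainder \<open>p < m\<close>; the summand 1 makes
    \<open>C\<close> positive.\<close>
  define C where "C = 1 + (\<Sum>p<m. a p / x ^ p)"
  have pos: "0 \<le> a p / x ^ p" for p using nn x by simp
  have "0 < C" unfolding C_def using sum_nonneg[of "{..<m}" "\<lambda>p. a p / x ^ p"] pos by force
  moreover have "a n \<le> C * x ^ n" for n
  proof -
    define q p where "q = n div m" and "p = n mod m"
    have n: "n = q * m + p" and p: "p < m" using m by (auto simp: q_def p_def)
    have "a p / x ^ p \<le> (\<Sum>p<m. a p / x ^ p)"
      using p pos by (intro member_le_sum) auto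
    then have ap: "a p \<le> C * x ^ p"
      using x by (simp add: C_def field_simps add_increasing)
    have "a n \<le> a m ^ q * a p" unfolding n by (rule submult_power_le[of a, OF nn sub])
    also have "\<dots> \<le> (x ^ m) ^ q * (C * x ^ p)"
      using am ap nn x by (intro mult_mono power_mono) auto
    also have "\<dots> = C * x ^ n" unfolding n by (simp add: power_add power_mult mult.commute)
    finally show ?thesis .
  qed
  ultimately show ?thesis by blast
qed

lemma root_power_mult_tendsto:
  fixes C x :: real
  assumes "0 < C" "0 \<le> x"
  shows "(\<lambda>n. root n (C * x ^ n)) \<longlonglongrightarrow> x"
proof -
  have "(\<lambda>n. root n C * x) \<longlonglongrightarrow> 1 * x"
    by (intro tendsto_mult LIMSEQ_root_const assms tendsto_const)
  moreover have "eventually (\<lambda>n. root n C * x = root n (C * x ^ n)) sequentially"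
    using eventually_gt_at_top[of 0]
    by eventually_elim (use assms in \<open>simp add: real_root_mult real_root_power_cancel\<close>)
  ultimately show ?thesis by (simp add: filterlim_cong[OF refl refl])
qed

text \<open>Fekete's lemma in multiplicative form: the limit is the infimum of the roots. It
  supplies the existence of the limits in (v), which upper bounds on the roots alone would not
  give.\<close>

lemma submult_root_convergent:
  fixes a :: "nat \<Rightarrow> real"
  assumes nn: "\<And>n. 0 \<le> a n" and sub: "\<And>m n. a (m + n) \<le> a m * a n"
  shows "\<exists>l. (\<lambda>n. root n (a n)) \<longlonglongrightarrow> l"
proof -
  \<comment> \<open>Index 0 is left out because \<open>root 0\<close> is 0 by convention and would
    force the infimum to be 0.\<close>
  define l where "l = (INF n\<in>{0<..}. root n (a n))"
  have bdd: "bdd_below ((\<lambda>n. root n (a n)) ` {0<..})"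
    by (rule bdd_belowI2[of _ 0]) (simp add: nn)
  have lower: "l \<le> root n (a n)" if "0 < n" for n
    unfolding l_def using that by (intro cINF_lower bdd) simp
  have "0 \<le> l" unfolding l_def by (rule cINF_greatest) (auto simp: nn)
  have "(\<lambda>n. root n (a n)) \<longlonglongrightarrow> l"
  proof (rule order_tendstoI)
    fix y assume "y < l"
    then show "eventually (\<lambda>n. y < root n (a n)) sequentially"
      by (intro eventually_mono[OF eventually_gt_at_top[of 0]]) (use lower less_le_trans in blast)
  next
    fix y assume "l < y"
    then obtain x where x: "l < x" "x < y" using dense by blast
    then obtain m where m: "0 < m" "root m (a m) < x"
      unfolding l_def using cINF_less_iff[OF _ bdd] by auto
    have "a m = root m (a m) ^ m" using m nn by simp
    also have "\<dots> \<le> x ^ m" using m nn by (intro power_mono) auto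
    finally obtain C where C: "0 < C" "\<And>n. a n \<le> C * x ^ n"
      using submult_geometric_bound[of a, OF nn sub m(1), of x] x \<open>0 \<le> l\<close> by auto
    have "eventually (\<lambda>n. root n (C * x ^ n) < y) sequentially"
      using order_tendstoD(2)[OF root_power_mult_tendsto[of C x]] C x \<open>0 \<le> l\<close> by auto
    then show "eventually (\<lambda>n. root n (a n) < y) sequentially"
      using eventually_gt_at_top[of 0]
      by eventually_elim (use C in \<open>meson le_less_trans real_root_le_mono\<close>)
  qed
  then show ?thesis ..
qed

lemma root_limit_le:
  fixes a :: "nat \<Rightarrow> real"
  assumes lim: "(\<lambda>n. root n (a n)) \<longlonglongrightarrow> l" and x: "0 \<le> x"
    and bound: "eventually (\<lambda>n. a n \<le> C * x ^ n) sequentially"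
  shows "l \<le> x"
proof -
  \<comment> \<open>The roots of \<open>C * x ^ n\<close> tend to \<open>x\<close> for a positive
    constant; enlarging \<open>C\<close> to at least 1 ensures this.\<close>
  define D where "D = max C 1"
  have "eventually (\<lambda>n. root n (a n) \<le> root n (D * x ^ n)) sequentially"
    using bound eventually_gt_at_top[of 0]
  proof eventually_elim
    case (elim n)
    have "C * x ^ n \<le> D * x ^ n" using x by (intro mult_right_mono) (auto simp: D_def)
    with elim show ?case by (intro real_root_le_mono) auto
  qed
  moreover have "(\<lambda>n. root n (D * x ^ n)) \<longlonglongrightarrow> x"
    by (rule root_power_mult_tendsto) (use x in \<open>auto simp: D_def\<close>)
  ultimately show ?thesis using lim by (intro tendsto_le[of sequentially]) auto
qed

text \<open>A limit strictly below \<open>x\<close> yields a single index \<open>m > 0\<close> with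
  \<open>a m <= x ^ m\<close>, and submultiplicativity spreads this to all indices. This turns (v)
  back into the decay in (a).\<close>

lemma root_limit_less_imp_geometric_bound:
  fixes a :: "nat \<Rightarrow> real"
  assumes nn: "\<And>n. 0 \<le> a n" and sub: "\<And>m n. a (m + n) \<le> a m * a n"
    and lim: "(\<lambda>n. root n (a n)) \<longlonglongrightarrow> l" and "l < x" "0 < x"
  shows "\<exists>C>0. \<forall>n. a n \<le> C * x ^ n"
proof -
  have "eventually (\<lambda>n. 0 < n \<and> root n (a n) < x) sequentially"
    using order_tendstoD(2)[OF lim \<open>l < x\<close>] eventually_gt_at_top[of 0] by eventually_elim simp
  then obtain m where m: "0 < m" "root m (a m) < x"
    by (auto simp: eventually_sequentially)
  have "a m = root m (a m) ^ m" using m nn by simp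
  also have "\<dots> \<le> x ^ m" using m nn by (intro power_mono) auto
  finally show ?thesis using submult_geometric_bound[of a, OF nn sub m(1) \<open>0 < x\<close>] by blast
qed

section \<open>Composition and powers of operators\<close>

lemma blinfun_compose_assoc: "(S o\<^sub>L T) o\<^sub>L U = S o\<^sub>L (T o\<^sub>L U)"
  by (auto intro: blinfun_eqI)

lemmas blinfun_compose_simps =
  blinfun_compose_assoc
  bounded_bilinear.add_left[OF bounded_bilinear_blinfun_compose]
  bounded_bilinear.add_right[OF bounded_bilinear_blinfun_compose]
  bounded_bilinear.diff_left[OF bounded_bilinear_blinfun_compose]
  bounded_bilinear.diff_right[OF bounded_bilinear_blinfun_compose]
  bounded_bilinear.minus_left[OF bounded_bilinear_blinfun_compose]
  bounded_bilinear.minus_right[OF bounded_bilinear_blinfun_compose]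
  bounded_bilinear.scaleR_left[OF bounded_bilinear_blinfun_compose]
  bounded_bilinear.scaleR_right[OF bounded_bilinear_blinfun_compose]
  bounded_bilinear.zero_left[OF bounded_bilinear_blinfun_compose]
  bounded_bilinear.zero_right[OF bounded_bilinear_blinfun_compose]

lemma blinfun_compose_id [simp]: "id_blinfun o\<^sub>L T = T" "T o\<^sub>L id_blinfun = T"
  by (auto intro: blinfun_eqI)

lemma op_power_add: "op_power T (m + n) = op_power T m o\<^sub>L op_power T n"
  by (induction m) (simp_all add: blinfun_compose_assoc)

lemma op_power_Suc_right: "op_power T (Suc n) = op_power T n o\<^sub>L T"
  using op_power_add[of T n 1] by simp

lemma norm_op_power_add:
  "norm (op_power T (m + n)) \<le> norm (op_power T m) * norm (op_power T n)"
  unfolding op_power_add by (rule norm_blinfun_compose)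

lemma compose_in_bounded_ops:
  "S \<in> bounded_ops \<Longrightarrow> T \<in> bounded_ops \<Longrightarrow> S o\<^sub>L T \<in> bounded_ops"
  by (simp add: bounded_ops_def)

section \<open>Laurent inverses of a pencil\<close>

text \<open>Evaluate \<open>R i o\<^sub>L A0 o\<^sub>L R j\<close> in two ways, by the right
  equation at \<open>j\<close> and by the left equation at \<open>i\<close>. The two conditional
  terms are the jumps met when \<open>j\<close> or \<open>i\<close> passes 0.\<close>

lemma laurent_compose_step:
  fixes A0 A1 :: "'h::real_normed_vector \<Rightarrow>\<^sub>L 'k::real_normed_vector" and R :: "int \<Rightarrow> 'k \<Rightarrow>\<^sub>L 'h"
  assumes left: "\<And>j. (R (j - 1) o\<^sub>L A1) + (R j o\<^sub>L A0) = (if j = 0 then id_blinfun else 0)"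
    and right: "\<And>j. (A1 o\<^sub>L R (j - 1)) + (A0 o\<^sub>L R j) = (if j = 0 then id_blinfun else 0)"
  shows "R i o\<^sub>L A1 o\<^sub>L R (j - 1) =
    (R (i - 1) o\<^sub>L A1 o\<^sub>L R j) + (if j = 0 then R i else 0) - (if i = 0 then R j else 0)"
proof -
  have "A1 o\<^sub>L R (j - 1) = (if j = 0 then id_blinfun else 0) - (A0 o\<^sub>L R j)"
    using right[of j] by (metis add_diff_cancel_right')
  then have "R i o\<^sub>L A1 o\<^sub>L R (j - 1) = (if j = 0 then R i else 0) - ((R i o\<^sub>L A0) o\<^sub>L R j)"
    by (simp add: blinfun_compose_simps)
  moreover have "R i o\<^sub>L A0 = (if i = 0 then id_blinfun else 0) - (R (i - 1) o\<^sub>L A1)"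
    using left[of i] by (metis add_diff_cancel_left')
  ultimately show ?thesis
    by (simp add: blinfun_compose_simps)
qed

text \<open>Raising \<open>i\<close> and lowering \<open>j\<close> together meets no jump, so the
  product is unchanged, while its norm is bounded by a constant times \<open>(x / y) ^ k\<close>,
  which tends to 0.\<close>

lemma laurent_compose_zero:
  fixes A0 A1 :: "'h::real_normed_vector \<Rightarrow>\<^sub>L 'k::real_normed_vector" and R :: "int \<Rightarrow> 'k \<Rightarrow>\<^sub>L 'h"
  assumes left: "\<And>j. (R (j - 1) o\<^sub>L A1) + (R j o\<^sub>L A0) = (if j = 0 then id_blinfun else 0)"
    and right: "\<And>j. (A1 o\<^sub>L R (j - 1)) + (A0 o\<^sub>L R j) = (if j = 0 then id_blinfun else 0)"
    and xy: "0 < x" "x < y"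
    and pos: "\<And>j::nat. 1 \<le> j \<Longrightarrow> norm (R (int j)) \<le> c / y ^ j"
    and neg: "\<And>j::nat. 1 \<le> j \<Longrightarrow> norm (R (- int j)) \<le> d * x ^ j"
    and ij: "0 \<le> i" "j \<le> -1"
  shows "R i o\<^sub>L A1 o\<^sub>L R j = 0"
proof -
  have shift: "R i o\<^sub>L A1 o\<^sub>L R j = R (i + int k) o\<^sub>L A1 o\<^sub>L R (j - int k)" for k
  proof (induction k)
    case (Suc k)
    have "R (i + int (Suc k)) o\<^sub>L A1 o\<^sub>L R (j - int k - 1) =
        R (i + int (Suc k) - 1) o\<^sub>L A1 o\<^sub>L R (j - int k)"
      using ij by (subst laurent_compose_step[OF left right]) auto
    with Suc show ?case by (simp add: algebra_simps)
  qed simp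
  obtain p where p: "i = int p" using ij nonneg_int_cases by blast
  obtain q where q: "j = - int q" using ij by (metis nonpos_int_cases le_minus_one_simps(1) order_trans)
  have q1: "1 \<le> q" using ij q by simp
  define C where "C = c / y ^ p * norm A1 * (d * x ^ q)"
  \<comment> \<open>The decay bounds start at index 1, so \<open>1 <= k\<close> is required to cover
    the case \<open>i = 0\<close>.\<close>
  have "norm (R i o\<^sub>L A1 o\<^sub>L R j) \<le> C * (x / y) ^ k" if "1 \<le> k" for k
  proof -
    have P: "norm (R (i + int k)) \<le> c / y ^ (p + k)" using pos[of "p + k"] that by (simp add: p)
    have N: "norm (R (j - int k)) \<le> d * x ^ (q + k)" using neg[of "q + k"] that by (simp add: q)
    have "norm (R i o\<^sub>L A1 o\<^sub>L R j) \<le> norm (R (i + int k)) * norm A1 * norm (R (j - int k))"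
      unfolding shift[of k]
      by (meson norm_blinfun_compose order_trans mult_right_mono norm_ge_zero)
    also have "\<dots> \<le> c / y ^ (p + k) * norm A1 * (d * x ^ (q + k))"
      using P N order_trans[OF norm_ge_zero P] by (intro mult_mono mult_nonneg_nonneg) auto
    also have "\<dots> = C * (x / y) ^ k"
      unfolding C_def by (simp add: power_add power_divide)
    finally show ?thesis .
  qed
  then have "eventually (\<lambda>k. norm (R i o\<^sub>L A1 o\<^sub>L R j) \<le> C * (x / y) ^ k) sequentially"
    by (auto simp: eventually_sequentially)
  moreover have "(\<lambda>k. C * (x / y) ^ k) \<longlonglongrightarrow> C * 0"
    by (intro tendsto_mult tendsto_const LIMSEQ_power_zero) (use xy in simp)
  ultimately have "norm (R i o\<^sub>L A1 o\<^sub>L R j) \<le> C * 0"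
    by (intro tendsto_le[of sequentially _ _ "\<lambda>_. norm (R i o\<^sub>L A1 o\<^sub>L R j)"]) auto
  then show ?thesis by simp
qed

lemma laurent_compose:
  fixes A0 A1 :: "'h::real_normed_vector \<Rightarrow>\<^sub>L 'k::real_normed_vector" and R :: "int \<Rightarrow> 'k \<Rightarrow>\<^sub>L 'h"
  assumes left: "\<And>j. (R (j - 1) o\<^sub>L A1) + (R j o\<^sub>L A0) = (if j = 0 then id_blinfun else 0)"
    and right: "\<And>j. (A1 o\<^sub>L R (j - 1)) + (A0 o\<^sub>L R j) = (if j = 0 then id_blinfun else 0)"
    and xy: "0 < x" "x < y"
    and pos: "\<And>j::nat. 1 \<le> j \<Longrightarrow> norm (R (int j)) \<le> c / y ^ j"
    and neg: "\<And>j::nat. 1 \<le> j \<Longrightarrow> norm (R (- int j)) \<le> d * x ^ j"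
  shows "i \<le> -1 \<Longrightarrow> j \<le> -1 \<Longrightarrow> R i o\<^sub>L A1 o\<^sub>L R j = R (i + j + 1)"
    and "0 \<le> i \<Longrightarrow> 0 \<le> j \<Longrightarrow> R i o\<^sub>L A1 o\<^sub>L R j = - R (i + j + 1)"
    and "0 \<le> i \<Longrightarrow> j \<le> -1 \<Longrightarrow> R i o\<^sub>L A1 o\<^sub>L R j = 0"
    and "0 \<le> j \<Longrightarrow> R (-1) o\<^sub>L A1 o\<^sub>L R j = 0"
proof -
  note step = laurent_compose_step[OF left right]
  have zero: "R i o\<^sub>L A1 o\<^sub>L R j = 0" if "0 \<le> i" "j \<le> -1" for i j
    using laurent_compose_zero[OF left right xy pos neg that] .
  have nonneg: "R i o\<^sub>L A1 o\<^sub>L R j = - R (i + j + 1)" if "0 \<le> i" "0 \<le> j" for i j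
    using that(2,1)
  proof (induction j arbitrary: i rule: int_ge_induct)
    case base
    \<comment> \<open>Moving from \<open>(i + 1, -1)\<close>, where the product vanishes, to
      \<open>(i, 0)\<close> crosses only the jump in the second index.\<close>
    then have "0 = (R i o\<^sub>L A1 o\<^sub>L R 0) + R (i + 1)"
      using step[of "i + 1" 0] zero[of "i + 1" "-1"] by simp
    then show ?case by (simp add: eq_neg_iff_add_eq_0)
  next
    case (step j)
    then have "R (i + 1) o\<^sub>L A1 o\<^sub>L R j = R i o\<^sub>L A1 o\<^sub>L R (j + 1)"
      using laurent_compose_step[OF left right, of "i + 1" "j + 1"] by simp
    with step.IH[of "i + 1"] step.prems show ?case by (simp add: algebra_simps)
  qed
  show "0 \<le> i \<Longrightarrow> 0 \<le> j \<Longrightarrow> R i o\<^sub>L A1 o\<^sub>L R j = - R (i + j + 1)"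
    by (rule nonneg)
  show "0 \<le> i \<Longrightarrow> j \<le> -1 \<Longrightarrow> R i o\<^sub>L A1 o\<^sub>L R j = 0"
    by (rule zero)
  show "i \<le> -1 \<Longrightarrow> j \<le> -1 \<Longrightarrow> R i o\<^sub>L A1 o\<^sub>L R j = R (i + j + 1)"
  proof (induction i arbitrary: j rule: int_le_induct)
    case base
    \<comment> \<open>Here the first index drops from 0 to -1; its jump \<open>R j\<close> is the
      whole value, since the product at \<open>(0, j - 1)\<close> vanishes.\<close>
    then show ?case using step[of 0 j] zero[of 0 "j - 1"] by simp
  next
    case (step i)
    then have "R i o\<^sub>L A1 o\<^sub>L R (j - 1) = R (i - 1) o\<^sub>L A1 o\<^sub>L R j"
      using laurent_compose_step[OF left right, of i j] by simp
    with step.IH[of "j - 1"] step.prems show ?case by (simp add: algebra_simps)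
  qed
  show "R (-1) o\<^sub>L A1 o\<^sub>L R j = 0" if "0 \<le> j"
  \<comment> \<open>For \<open>j = 0\<close> the two jumps are both \<open>R 0\<close> and cancel;
    for \<open>j > 0\<close> the single jump cancels the value \<open>- R j\<close> at
    \<open>(0, j - 1)\<close>.\<close>
  proof (cases "j = 0")
    case True
    then show ?thesis using step[of 0 0] zero[of 0 "-1"] by simp
  next
    case False
    then show ?thesis using step[of 0 j] nonneg[of 0 "j - 1"] that by simp
  qed
qed

text \<open>The off-diagonal blocks vanish: intertwining turns \<open>Q A (I - P)\<close> into
  \<open>A P (I - P) = 0\<close> and \<open>(I - Q) A P\<close> into
  \<open>A P - A P P = 0\<close>.\<close>

lemma intertwining_imp_block_diagonal:
  assumes "P o\<^sub>L P = P" and comm: "Q o\<^sub>L A = A o\<^sub>L P"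
  shows "A = (Q o\<^sub>L A o\<^sub>L P) + ((id_blinfun - Q) o\<^sub>L A o\<^sub>L (id_blinfun - P))"
  by (simp add: comm blinfun_compose_simps assms(1) blinfun_compose_assoc[of Q A, symmetric])

text \<open>Multiplying the decomposition by \<open>Q\<close> on the left or by \<open>P\<close> on
  the right leaves the same block \<open>Q A P\<close>.\<close>

lemma block_diagonal_imp_intertwining:
  assumes P: "P o\<^sub>L P = P" and Q: "Q o\<^sub>L Q = Q"
    and A: "A = (Q o\<^sub>L A o\<^sub>L P) + ((id_blinfun - Q) o\<^sub>L A o\<^sub>L (id_blinfun - P))"
  shows "Q o\<^sub>L A = A o\<^sub>L P"
proof -
  have QQ: "Q o\<^sub>L (Q o\<^sub>L X) = Q o\<^sub>L X" for X
    by (simp add: Q flip: blinfun_compose_assoc)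
  have "Q o\<^sub>L A = Q o\<^sub>L A o\<^sub>L P"
    by (subst A) (simp add: blinfun_compose_simps P QQ)
  moreover have "A o\<^sub>L P = Q o\<^sub>L A o\<^sub>L P"
    by (subst A) (simp add: blinfun_compose_simps P)
  ultimately show ?thesis by simp
qed

lemma signed_op_power_iterate:
  assumes "\<And>n. X (Suc n) = - (T o\<^sub>L X n)"
  shows "X n = (-1) ^ n *\<^sub>R (op_power T n o\<^sub>L X 0)"
  by (induction n) (simp_all add: assms blinfun_compose_simps)

text \<open>One more factor \<open>A\<close> on the right completes the power:
  \<open>(B A)^(n + 1)\<close> is \<open>X A\<close> up to sign. Bounds on the coefficients
  \<open>R j\<close> thereby become bounds on the powers in (v).\<close>

lemma norm_op_power_Suc_le:
  assumes "X = (-1) ^ n *\<^sub>R (op_power (B o\<^sub>L A) n o\<^sub>L B)"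
  shows "norm (op_power (B o\<^sub>L A) (Suc n)) \<le> norm X * norm A"
proof -
  have "op_power (B o\<^sub>L A) (Suc n) = (-1) ^ n *\<^sub>R (X o\<^sub>L A)"
    unfolding assms op_power_Suc_right by (simp add: blinfun_compose_simps flip: power_mult_distrib)
  then show ?thesis by (simp add: norm_blinfun_compose power_abs)
qed

theorem theorem2:
  fixes A0 A1 :: "'h::complex_banach \<Rightarrow>\<^sub>L 'k::complex_banach"
    and R :: "int \<Rightarrow> ('k \<Rightarrow>\<^sub>L 'h)"
    and s r :: real
  assumes "A0 \<in> bounded_ops" and "A1 \<in> bounded_ops"
    and "singular_op A0"
    and "0 \<le> s" and "s < r"
    and "\<And>j. R j \<in> bounded_ops"
  shows
    "((\<forall>\<delta>>0. \<forall>\<epsilon>>0. s < s + \<epsilon> \<and> s + \<epsilon> < r - \<delta> \<and> r - \<delta> < r \<longrightarrow>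
         (\<exists>c d :: real. \<forall>j::nat. 1 \<le> j \<longrightarrow>
            norm (R (int j)) \<le> c / (r - \<delta>) ^ j \<and>
            norm (R (- int j)) \<le> d * (s + \<epsilon>) ^ j)) \<and>
      ((R (-1) o\<^sub>L A1) + (R 0 o\<^sub>L A0) = id_blinfun \<and>
       (\<forall>j. j \<noteq> 0 \<longrightarrow> (R (j - 1) o\<^sub>L A1) + (R j o\<^sub>L A0) = 0)) \<and>
      ((A1 o\<^sub>L R (-1)) + (A0 o\<^sub>L R 0) = id_blinfun \<and>
       (\<forall>j. j \<noteq> 0 \<longrightarrow> (A1 o\<^sub>L R (j - 1)) + (A0 o\<^sub>L R j) = 0)))
     \<longleftrightarrow>
     (let P = R (-1) o\<^sub>L A1; Q = A1 o\<^sub>L R (-1); P' = id_blinfun - P; Q' = id_blinfun - Q in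
      (P' = R 0 o\<^sub>L A0 \<and> complementary_projections P P' \<and>
       Q' = A0 o\<^sub>L R 0 \<and> complementary_projections Q Q') \<and>
      (A0 = (Q o\<^sub>L A0 o\<^sub>L P) + (Q' o\<^sub>L A0 o\<^sub>L P') \<and>
       A1 = (Q o\<^sub>L A1 o\<^sub>L P) + (Q' o\<^sub>L A1 o\<^sub>L P')) \<and>
      ((\<forall>j. j \<le> -1 \<longrightarrow> R j = P o\<^sub>L R j o\<^sub>L Q) \<and>
       (\<forall>j. 0 \<le> j \<longrightarrow> R j = P' o\<^sub>L R j o\<^sub>L Q')) \<and>
      (\<forall>j::nat. 1 \<le> j \<longrightarrow>
         R (- int j) = (-1) ^ (j - 1) *\<^sub>R (op_power (R (-1) o\<^sub>L A0) (j - 1) o\<^sub>L R (-1)) \<and>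
         R (int j) = (-1) ^ j *\<^sub>R (op_power (R 0 o\<^sub>L A1) j o\<^sub>L R 0)) \<and>
      ((\<exists>l. (\<lambda>j. root j (norm (op_power (R (-1) o\<^sub>L A0) j))) \<longlonglongrightarrow> l \<and> l \<le> s) \<and>
       (\<exists>l. (\<lambda>j. root j (norm (op_power (R 0 o\<^sub>L A1) j))) \<longlonglongrightarrow> l \<and> l \<le> 1 / r)))"
proof -
  define P Q where "P = R (-1) o\<^sub>L A1" and "Q = A1 o\<^sub>L R (-1)"
  define P' Q' where "P' = id_blinfun - P" and "Q' = id_blinfun - Q"
  define T S where "T = R (-1) o\<^sub>L A0" and "S = R 0 o\<^sub>L A1"
  show ?thesis
  proof (unfold Let_def, fold P_def Q_def T_def S_def, fold P'_def Q'_def, rule iffI, goal_cases)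

    \<comment> \<open>Decay and the fundamental equations imply (i)--(v)\<close>
    case 1
    note decay = 1[THEN conjunct1, rule_format]
    have left: "(R (j - 1) o\<^sub>L A1) + (R j o\<^sub>L A0) = (if j = 0 then id_blinfun else 0)" for j
      using 1[THEN conjunct2, THEN conjunct1] by (auto simp: P_def)
    have right: "(A1 o\<^sub>L R (j - 1)) + (A0 o\<^sub>L R j) = (if j = 0 then id_blinfun else 0)" for j
      using 1[THEN conjunct2, THEN conjunct2] by (auto simp: Q_def)
    \<comment> \<open>Condition (a) with \<open>x = s + \<epsilon>\<close> and
      \<open>y = r - \<delta>\<close>.\<close>
    have bounds: "\<exists>c d :: real. \<forall>j::nat. 1 \<le> j \<longrightarrow>
        norm (R (int j)) \<le> c / y ^ j \<and> norm (R (- int j)) \<le> d * x ^ j"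
      if "s < x" "x < y" "y < r" for x y
      using decay[of "r - y" "x - s"] that by simp
    obtain x y where xy: "s < x" "x < y" "y < r" using \<open>s < r\<close> dense by meson
    obtain c d where cd: "\<And>j::nat. 1 \<le> j \<Longrightarrow> norm (R (int j)) \<le> c / y ^ j"
        "\<And>j::nat. 1 \<le> j \<Longrightarrow> norm (R (- int j)) \<le> d * x ^ j"
      using bounds[OF xy] by blast
    have "0 < x" using xy \<open>0 \<le> s\<close> by simp
    note F = laurent_compose[OF left right \<open>0 < x\<close> xy(2) cd]
    have P': "P' = R 0 o\<^sub>L A0"
      using left[of 0] by (simp add: P'_def P_def diff_eq_eq add.commute)
    have Q': "Q' = A0 o\<^sub>L R 0"
      using right[of 0] by (simp add: Q'_def Q_def diff_eq_eq add.commute)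
    have PP: "P o\<^sub>L P = P"
      using F(1)[of "-1" "-1"] by (simp add: P_def flip: blinfun_compose_assoc)
    have QQ: "Q o\<^sub>L Q = Q"
      using F(1)[of "-1" "-1"] by (simp add: Q_def blinfun_compose_assoc)
    have cP: "complementary_projections P P'"
      using assms PP unfolding complementary_projections_def projection_def
      by (auto simp: P' P_def intro: compose_in_bounded_ops)
         (simp_all add: P'[symmetric] P_def[symmetric], simp_all add: P'_def blinfun_compose_simps)
    have cQ: "complementary_projections Q Q'"
      using assms QQ unfolding complementary_projections_def projection_def
      by (auto simp: Q' Q_def intro: compose_in_bounded_ops)
         (simp_all add: Q'[symmetric] Q_def[symmetric], simp_all add: Q'_def blinfun_compose_simps)
    \<comment> \<open>Both equations at index -1 pass through \<open>R (-2)\<close>: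
      \<open>A0 R (-1) A1\<close> and \<open>A1 R (-1) A0\<close> both equal
      \<open>- A1 R (-2) A1\<close>. This is the intertwining relation for \<open>A0\<close>; the
      one for \<open>A1\<close> is associativity.\<close>
    have T: "T = - (R (-2) o\<^sub>L A1)"
      using left[of "-1"] by (simp add: T_def eq_neg_iff_add_eq_0 add.commute)
    have "A0 o\<^sub>L R (-1) = - (A1 o\<^sub>L R (-2))"
      using right[of "-1"] by (simp add: eq_neg_iff_add_eq_0 add.commute)
    then have "(A0 o\<^sub>L R (-1)) o\<^sub>L A1 = A1 o\<^sub>L T"
      by (simp add: T blinfun_compose_simps)
    then have comm0: "Q o\<^sub>L A0 = A0 o\<^sub>L P"
      by (simp add: Q_def P_def T_def blinfun_compose_assoc)
    have comm1: "Q o\<^sub>L A1 = A1 o\<^sub>L P"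
      by (simp add: Q_def P_def blinfun_compose_assoc)
    note blocks = intertwining_imp_block_diagonal[OF PP comm0, folded P'_def Q'_def]
      intertwining_imp_block_diagonal[OF PP comm1, folded P'_def Q'_def]
    have neg: "R j = P o\<^sub>L R j o\<^sub>L Q" if "j \<le> -1" for j
      using F(1)[of "-1" j] F(1)[of j "-1"] that
      by (simp add: P_def Q_def blinfun_compose_assoc)
    \<comment> \<open>The vanishing mixed products say that \<open>P R j = 0\<close> and
      \<open>R j Q = 0\<close>, so the complementary projections fix \<open>R j\<close>.\<close>
    have nonneg: "R j = P' o\<^sub>L R j o\<^sub>L Q'" if "0 \<le> j" for j
      using F(3)[of j "-1"] F(4)[of j] that
      by (simp add: P'_def Q'_def P_def Q_def blinfun_compose_simps)
    have Rneg: "R (- int (Suc n)) = (-1) ^ n *\<^sub>R (op_power T n o\<^sub>L R (-1))" for n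
    proof -
      have "R (- int (Suc (Suc n))) = - (T o\<^sub>L R (- int (Suc n)))" for n
        using F(1)[of "-2" "- int (Suc n)"] by (simp add: T blinfun_compose_simps)
      from signed_op_power_iterate[of "\<lambda>n. R (- int (Suc n))", OF this] show ?thesis by simp
    qed
    have Rpos: "R (int n) = (-1) ^ n *\<^sub>R (op_power S n o\<^sub>L R 0)" for n
    proof -
      have "R (int (Suc n)) = - (S o\<^sub>L R (int n))" for n
        using F(2)[of 0 "int n"] by (simp add: S_def add.commute)
      from signed_op_power_iterate[of "\<lambda>n. R (int n)", OF this] show ?thesis by simp
    qed
    obtain lT where lT: "(\<lambda>j. root j (norm (op_power T j))) \<longlonglongrightarrow> lT"
      using submult_root_convergent[of "\<lambda>j. norm (op_power T j)"] norm_op_power_add by auto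
    obtain lS where lS: "(\<lambda>j. root j (norm (op_power S j))) \<longlonglongrightarrow> lS"
      using submult_root_convergent[of "\<lambda>j. norm (op_power S j)"] norm_op_power_add by auto
    \<comment> \<open>Every \<open>x\<close> strictly between \<open>s\<close> and \<open>r\<close>
      is shown to bound \<open>lT\<close>, and density gives \<open>lT <= s\<close>. The auxiliary
      \<open>y\<close> only serves to invoke \<open>bounds\<close>.\<close>
    have "lT \<le> x" if x: "s < x" "x < r" for x
    proof -
      obtain y where y: "x < y" "y < r" using x dense by blast
      then obtain d where d: "\<And>j::nat. 1 \<le> j \<Longrightarrow> norm (R (- int j)) \<le> d * x ^ j"
        using bounds[of x y] x by blast
      have "norm (op_power T n) \<le> d * norm A0 * x ^ n" if n: "0 < n" for n
      proof -
        obtain m where m: "n = Suc m" using n gr0_implies_Suc by blast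
        have "norm (op_power T n) \<le> norm (R (- int n)) * norm A0"
          unfolding m T_def by (rule norm_op_power_Suc_le) (simp only: Rneg T_def)
        also have "\<dots> \<le> d * x ^ n * norm A0"
          using d[of n] n by (intro mult_right_mono) auto
        finally show ?thesis by (simp add: mult_ac)
      qed
      then have "eventually (\<lambda>n. norm (op_power T n) \<le> d * norm A0 * x ^ n) sequentially"
        by (rule eventually_mono[OF eventually_gt_at_top[of 0]])
      then show ?thesis using x \<open>0 \<le> s\<close> by (intro root_limit_le[OF lT]) auto
    qed
    then have lTs: "lT \<le> s" by (rule dense_ge_bounded[OF \<open>s < r\<close>])
    have lSy: "lS \<le> 1 / y" if y: "s < y" "y < r" for y
    proof -
      obtain x where x: "s < x" "x < y" using y dense by blast
      then obtain c where c: "\<And>j::nat. 1 \<le> j \<Longrightarrow> norm (R (int j)) \<le> c / y ^ j"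
        using bounds[of x y] y by blast
      have "0 < y" using y \<open>0 \<le> s\<close> by simp
      \<comment> \<open>The power \<open>n\<close> of \<open>S\<close> is governed by
        \<open>R (n - 1)\<close>. This shift produces the factor \<open>y\<close> and requires
        \<open>n > 1\<close>, since the decay bound starts at index 1.\<close>
      have "norm (op_power S n) \<le> c * y * norm A1 * (1 / y) ^ n" if n: "1 < n" for n
      proof -
        obtain m where m: "n = Suc m" "0 < m" using n by (cases n) auto
        have "norm (op_power S n) \<le> norm (R (int m)) * norm A1"
          unfolding m S_def by (rule norm_op_power_Suc_le) (simp only: Rpos S_def)
        also have "\<dots> \<le> c / y ^ m * norm A1"
          using c[of m] m by (intro mult_right_mono) auto
        finally show ?thesis using \<open>0 < y\<close> m by (simp add: power_divide)
      qed
      then have "eventually (\<lambda>n. norm (op_power S n) \<le> c * y * norm A1 * (1 / y) ^ n) sequentially"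
        by (rule eventually_mono[OF eventually_gt_at_top[of 1]])
      then show ?thesis using \<open>0 < y\<close> by (intro root_limit_le[OF lS]) auto
    qed
    have lSr: "lS \<le> 1 / r"
    proof -
      \<comment> \<open>Let \<open>y\<close> increase to \<open>r\<close>; in product form the
        inequality is linear in \<open>y\<close>.\<close>
      have "y * lS \<le> 1" if "s < y" "y < r" for y
        using lSy[OF that] that \<open>0 \<le> s\<close> by (simp add: field_simps)
      moreover have "((\<lambda>y. y * lS) \<longlongrightarrow> r * lS) (at_left r)"
        by (intro tendsto_intros)
      ultimately have "r * lS \<le> 1"
        using \<open>s < r\<close>
        by (intro tendsto_upperbound[of "\<lambda>y. y * lS" _ "at_left r"])
           (auto simp: eventually_at_left_field)
      then show ?thesis using \<open>0 \<le> s\<close> \<open>s < r\<close> by (simp add: field_simps)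
    qed
    have Rneg': "R (- int j) = (-1) ^ (j - 1) *\<^sub>R (op_power T (j - 1) o\<^sub>L R (-1))" if "1 \<le> j" for j
      using Rneg[of "j - 1"] that by simp
    show ?case
      using P' cP Q' cQ blocks neg nonneg Rneg' Rpos lT lTs lS lSr by blast
  next

    \<comment> \<open>Conditions (i)--(v) imply decay and the fundamental equations\<close>
    case 2
    then have P': "P' = R 0 o\<^sub>L A0" and Q': "Q' = A0 o\<^sub>L R 0"
      and PP: "P o\<^sub>L P = P" and QQ: "Q o\<^sub>L Q = Q"
      and neg: "\<And>j. j \<le> -1 \<Longrightarrow> R j = P o\<^sub>L R j o\<^sub>L Q"
      and nonneg: "\<And>j. 0 \<le> j \<Longrightarrow> R j = P' o\<^sub>L R j o\<^sub>L Q'"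
      and Rneg1: "\<And>j. 1 \<le> j \<Longrightarrow>
        R (- int j) = (-1) ^ (j - 1) *\<^sub>R (op_power T (j - 1) o\<^sub>L R (-1))"
      and Rpos1: "\<And>j. 1 \<le> j \<Longrightarrow> R (int j) = (-1) ^ j *\<^sub>R (op_power S j o\<^sub>L R 0)"
      unfolding complementary_projections_def projection_def by blast+
    from 2 obtain lT lS where lT: "(\<lambda>j. root j (norm (op_power T j))) \<longlonglongrightarrow> lT" "lT \<le> s"
      and lS: "(\<lambda>j. root j (norm (op_power S j))) \<longlonglongrightarrow> lS" "lS \<le> 1 / r"
      by blast
    have comm0: "Q o\<^sub>L A0 = A0 o\<^sub>L P"
      by (rule block_diagonal_imp_intertwining[OF PP QQ]) (use 2 in \<open>unfold P'_def Q'_def, blast\<close>)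
    have comm1: "Q o\<^sub>L A1 = A1 o\<^sub>L P"
      by (simp add: Q_def P_def blinfun_compose_assoc)
    have Rneg: "R (- int (Suc n)) = (-1) ^ n *\<^sub>R (op_power T n o\<^sub>L R (-1))" for n
      using Rneg1[of "Suc n"] by simp
    have Rpos: "R (int n) = (-1) ^ n *\<^sub>R (op_power S n o\<^sub>L R 0)" for n
      using Rpos1[of n] by (cases n) auto
    have P'P': "P' o\<^sub>L P' = P'" and Q'Q': "Q' o\<^sub>L Q' = Q'"
      by (simp_all add: P'_def Q'_def blinfun_compose_simps PP QQ)
    have comm1': "Q' o\<^sub>L A1 = A1 o\<^sub>L P'"
      by (simp add: P'_def Q'_def blinfun_compose_simps comm1)
    have Rneg_P: "P o\<^sub>L R j = R j" and Rneg_Q: "R j o\<^sub>L Q = R j" if "j \<le> -1" for j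
      by (subst (1 2) neg[OF that], simp add: PP flip: blinfun_compose_assoc)
         (subst (1 2) neg[OF that], simp add: QQ blinfun_compose_assoc)
    have Rpos_P: "P' o\<^sub>L R j = R j" and Rpos_Q: "R j o\<^sub>L Q' = R j" if "0 \<le> j" for j
      by (subst (1 2) nonneg[OF that], simp add: P'P' flip: blinfun_compose_assoc)
         (subst (1 2) nonneg[OF that], simp add: Q'Q' blinfun_compose_assoc)
    \<comment> \<open>Intertwining moves \<open>P\<close> across \<open>A0\<close>, where it becomes
      \<open>Q\<close> and is absorbed by \<open>R (-1)\<close>; likewise \<open>P'\<close> moves
      across \<open>A1\<close> and is absorbed by \<open>R 0\<close> as \<open>Q'\<close>.\<close>
    have TP: "T o\<^sub>L P = T"
      using Rneg_Q[of "-1"] by (simp add: T_def blinfun_compose_assoc comm0[symmetric])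
        (simp flip: blinfun_compose_assoc)
    have SP': "S o\<^sub>L P' = S"
      using Rpos_Q[of 0] by (simp add: S_def blinfun_compose_assoc comm1'[symmetric])
        (simp flip: blinfun_compose_assoc)
    have Tstep: "R (- int (Suc (Suc n))) = - (T o\<^sub>L R (- int (Suc n)))" for n
      unfolding Rneg by (simp add: blinfun_compose_simps)
    have Sstep: "R (int (Suc n)) = - (S o\<^sub>L R (int n))" for n
      unfolding Rpos by (simp add: blinfun_compose_simps)
    \<comment> \<open>Both terms are the same power of \<open>T\<close> with opposite signs: the
      first ends in \<open>R (-1) A1 = P\<close>, which \<open>T\<close> absorbs, and the second
      ends in \<open>R (-1) A0 = T\<close>.\<close>
    have left_neg: "(R (- int (Suc (Suc n))) o\<^sub>L A1) + (R (- int (Suc n)) o\<^sub>L A0) = 0" for n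
    proof -
      have "op_power T (Suc n) o\<^sub>L P = op_power T (Suc n)"
        unfolding op_power_Suc_right by (simp add: blinfun_compose_assoc TP)
      then have "R (- int (Suc (Suc n))) o\<^sub>L A1 = (-1) ^ Suc n *\<^sub>R op_power T (Suc n)"
        unfolding Rneg by (simp add: blinfun_compose_simps P_def)
      moreover have "R (- int (Suc n)) o\<^sub>L A0 = (-1) ^ n *\<^sub>R op_power T (Suc n)"
        unfolding Rneg op_power_Suc_right by (simp add: blinfun_compose_simps T_def)
      ultimately show ?thesis by simp
    qed
    have left_pos: "(R (int n) o\<^sub>L A1) + (R (int (Suc n)) o\<^sub>L A0) = 0" for n
    proof -
      have "op_power S (Suc n) o\<^sub>L P' = op_power S (Suc n)"
        unfolding op_power_Suc_right by (simp add: blinfun_compose_assoc SP')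
      then have "R (int (Suc n)) o\<^sub>L A0 = (-1) ^ Suc n *\<^sub>R op_power S (Suc n)"
        unfolding Rpos by (simp add: blinfun_compose_simps P')
      moreover have "R (int n) o\<^sub>L A1 = (-1) ^ n *\<^sub>R op_power S (Suc n)"
        unfolding Rpos op_power_Suc_right by (simp add: blinfun_compose_simps S_def)
      ultimately show ?thesis by simp
    qed
    have right_neg: "(A1 o\<^sub>L R (- int (Suc (Suc n)))) + (A0 o\<^sub>L R (- int (Suc n))) = 0" for n
    proof -
      \<comment> \<open>Since \<open>A1 T = Q A0\<close>, intertwining gives \<open>A0 P\<close>,
        and \<open>P\<close> fixes the coefficients of negative index.\<close>
      have "A1 o\<^sub>L T = A0 o\<^sub>L P"
        using comm0 by (simp add: Q_def T_def blinfun_compose_assoc)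
      then have "(A1 o\<^sub>L T) o\<^sub>L R (- int (Suc n)) = (A0 o\<^sub>L P) o\<^sub>L R (- int (Suc n))"
        by simp
      then have "A1 o\<^sub>L (T o\<^sub>L R (- int (Suc n))) = A0 o\<^sub>L R (- int (Suc n))"
        using Rneg_P[of "- int (Suc n)"] by (simp add: blinfun_compose_assoc)
      then show ?thesis unfolding Tstep by (simp add: blinfun_compose_simps)
    qed
    have right_pos: "(A1 o\<^sub>L R (int n)) + (A0 o\<^sub>L R (int (Suc n))) = 0" for n
    proof -
      have "A0 o\<^sub>L S = A1 o\<^sub>L P'"
        using comm1' by (simp add: Q' S_def blinfun_compose_assoc)
      then have "(A0 o\<^sub>L S) o\<^sub>L R (int n) = (A1 o\<^sub>L P') o\<^sub>L R (int n)"
        by simp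
      then have "A0 o\<^sub>L (S o\<^sub>L R (int n)) = A1 o\<^sub>L R (int n)"
        using Rpos_P[of "int n"] by (simp add: blinfun_compose_assoc)
      then show ?thesis unfolding Sstep by (simp add: blinfun_compose_simps)
    qed
    have index_cases: "(\<exists>n. j = - int (Suc n)) \<or> (\<exists>n. j = int (Suc n))" if "j \<noteq> 0" for j :: int
      using that by (cases j rule: int_cases3) (metis Suc_pred)+
    have left: "(R (j - 1) o\<^sub>L A1) + (R j o\<^sub>L A0) = 0"
      and right: "(A1 o\<^sub>L R (j - 1)) + (A0 o\<^sub>L R j) = 0" if "j \<noteq> 0" for j
    proof -
      have shift: "- int (Suc n) - 1 = - int (Suc (Suc n))" "int (Suc n) - 1 = int n" for n by simp_all
      show "(R (j - 1) o\<^sub>L A1) + (R j o\<^sub>L A0) = 0" "(A1 o\<^sub>L R (j - 1)) + (A0 o\<^sub>L R j) = 0"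
        using index_cases[OF that] left_neg left_pos right_neg right_pos by (metis shift)+
    qed
    have decay: "\<exists>c d :: real. \<forall>j::nat. 1 \<le> j \<longrightarrow>
        norm (R (int j)) \<le> c / y ^ j \<and> norm (R (- int j)) \<le> d * x ^ j"
      if "s < x" "x < y" "y < r" for x y
    proof -
      have pos: "0 < x" "0 < y" using that \<open>0 \<le> s\<close> by auto
      have "1 / r < 1 / y" using that pos by (simp add: frac_less2)
      obtain C where C: "\<And>n. norm (op_power T n) \<le> C * x ^ n"
        using root_limit_less_imp_geometric_bound[OF norm_ge_zero norm_op_power_add lT(1), of x]
          le_less_trans[OF lT(2) \<open>s < x\<close>] pos by auto
      obtain D where D: "\<And>n. norm (op_power S n) \<le> D * (1 / y) ^ n"
        using root_limit_less_imp_geometric_bound[OF norm_ge_zero norm_op_power_add lS(1), of "1 / y"]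
          le_less_trans[OF lS(2) \<open>1 / r < 1 / y\<close>] pos by auto
      have "norm (R (int j)) \<le> (D * norm (R 0)) / y ^ j" for j
      proof -
        have "norm (R (int j)) \<le> norm (op_power S j) * norm (R 0)"
          unfolding Rpos by (simp add: norm_blinfun_compose power_abs)
        also have "\<dots> \<le> D * (1 / y) ^ j * norm (R 0)" by (intro mult_right_mono D) simp
        finally show ?thesis by (simp add: power_divide)
      qed
      \<comment> \<open>\<open>R (- int j)\<close> contains only the power \<open>j - 1\<close> of
        \<open>T\<close>, hence the division by \<open>x\<close> in the constant.\<close>
      moreover have "norm (R (- int j)) \<le> (C * norm (R (-1)) / x) * x ^ j" if j: "1 \<le> j" for j
      proof -
        obtain m where m: "j = Suc m" using j by (cases j) auto
        have "norm (R (- int j)) \<le> norm (op_power T m) * norm (R (-1))"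
          unfolding m Rneg by (simp add: norm_blinfun_compose power_abs)
        also have "\<dots> \<le> C * x ^ m * norm (R (-1))" by (intro mult_right_mono C) simp
        finally show ?thesis using pos by (simp add: m mult_ac)
      qed
      ultimately show ?thesis by blast
    qed
    \<comment> \<open>The equations at index 0 are \<open>P + P' = I\<close> and
      \<open>Q + Q' = I\<close> with \<open>P' = R 0 A0\<close> and
      \<open>Q' = A0 R 0\<close>.\<close>
    show ?case
      using decay left right P' Q' by (auto simp: P'_def Q'_def algebra_simps)
  qed
qed

end
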